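(* Let $0<c\le1$, and let $f\in\mathcal{S}^*(q_c)$ and $g\in\mathcal{C}(q_c)$ be related by $g=J[f]$. Then the pre-Schwarzian norm satisfies $$\|P_g\|=\|P_{J[f]}\|\le \frac{(1-\alpha^2)(1-\sqrt{1-c\alpha})}{\alpha},$$ where $\alpha$ is the unique root in $(0,1)$ of the equation $$2(1+r^2)(1-\sqrt{1-cr})-c(r+3r^3)=0.$$ The inequality is sharp, i.e. equality holds for some such pair $f$, $g=J[f]$.
   Context: $\mathbb{D}=\{z\in\mathbb{C}:|z|<1\}$. $\mathcal{A}$ is the class of analytic functions $f$ on $\mathbb{D}$ with $f(0)=0$ and $f'(0)=1$. For $F,G$ analytic on $\mathbb{D}$, $F\prec G$ ($F$ is subordinate to $G$) means there is an analytic $\omega:\mathbb{D}\to\mathbb{D}$ with $\omega(0)=0$ and $F(z)=G(\omega(z))$ for all $z\in\mathbb{D}$. For $0<c\le1$, $$\mathcal{S}^*(q_c)=\left\{f\in\mathcal{A}:\frac{zf'(z)}{f(z)}\prec \sqrt{1+cz}\right\},\qquad \mathcal{C}(q_c)=\left\{f\in\mathcal{A}:1+\frac{zf''(z)}{f'(z)}\prec \sqrt{1+cz}\right\},$$ where the square root is the principal branch (value $1$ at $z=0$) and $zf'(z)/f(z)$ is understood to take the value $1$ at $z=0$. The Alexander transformation of $f\in\mathcal{A}$ is $J[f](z)=\int_0^z\frac{f(t)}{t}\,dt$; one has $f\in\mathcal{S}^*(q_c)$ if and only if $J[f]\in\mathcal{C}(q_c)$. For a locally univalent analytic $f$ on $\mathbb{D}$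 (i.e. $f'(z)\neq0$ for all $z\in\mathbb{D}$), $P_f(z)=f''(z)/f'(z)$ is the pre-Schwarzian derivative and $\|P_f\|=\sup_{z\in\mathbb{D}}(1-|z|^2)|P_f(z)|$ is the pre-Schwarzian norm. *)

theory Defs
  imports "HOL-Complex_Analysis.Complex_Analysis"
begin

text \<open>
  Functions on the unit disc are total functions \<^typ>\<open>complex \<Rightarrow> complex\<close>; only their values on
  \<^term>\<open>ball (0::complex) 1\<close> matter.
\<close>

definition class_A :: "(complex \<Rightarrow> complex) set" where
  "class_A = {f. f holomorphic_on ball 0 1 \<and> f 0 = 0 \<and> deriv f 0 = 1}"

definition subordinate :: "(complex \<Rightarrow> complex) \<Rightarrow> (complex \<Rightarrow> complex) \<Rightarrow> bool" where
  "subordinate F G \<longleftrightarrow>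
     F holomorphic_on ball 0 1 \<and> G holomorphic_on ball 0 1 \<and>
     (\<exists>\<omega>. \<omega> holomorphic_on ball 0 1 \<and> \<omega> ` ball 0 1 \<subseteq> ball 0 1 \<and> \<omega> 0 = 0 \<and>
          (\<forall>z\<in>ball 0 1. F z = G (\<omega> z)))"

definition q :: "real \<Rightarrow> complex \<Rightarrow> complex" where
  "q c z = csqrt (1 + complex_of_real c * z)"

text \<open>
  In the next two definitions the nonvanishing of the denominator, implicit in writing the
  quotient, is stated explicitly because division by zero is total in HOL.
\<close>

definition starlike_q :: "real \<Rightarrow> (complex \<Rightarrow> complex) set" where
  "starlike_q c =
     {f \<in> class_A. (\<forall>z\<in>ball 0 1 - {0}. f z \<noteq> 0) \<and>
        subordinate (\<lambda>z. if z = 0 then 1 else z * deriv f z / f z) (q c)}"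

definition convex_q :: "real \<Rightarrow> (complex \<Rightarrow> complex) set" where
  "convex_q c =
     {f \<in> class_A. (\<forall>z\<in>ball 0 1. deriv f z \<noteq> 0) \<and>
        subordinate (\<lambda>z. 1 + z * deriv (deriv f) z / deriv f z) (q c)}"

text \<open>
  The integrand takes the value 0 rather than \<^term>\<open>deriv f 0\<close> at the starting point of the
  segment; this does not affect the integral.
\<close>

definition alexander :: "(complex \<Rightarrow> complex) \<Rightarrow> complex \<Rightarrow> complex" where
  "alexander f z = contour_integral (linepath 0 z) (\<lambda>t. f t / t)"

definition pre_schwarzian :: "(complex \<Rightarrow> complex) \<Rightarrow> complex \<Rightarrow> complex" where
  "pre_schwarzian f z = deriv (deriv f) z / deriv f z"

text \<open>
  The supremum is taken in \<^typ>\<open>ereal\<close>, so that it is \<^term>\<open>\<infinity> :: ereal\<close> when the set is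
  unbounded, and an upper bound on the norm entails boundedness.
\<close>

definition pre_schwarzian_norm :: "(complex \<Rightarrow> complex) \<Rightarrow> ereal" where
  "pre_schwarzian_norm f =
     (SUP z\<in>ball 0 1. ereal ((1 - (cmod z)\<^sup>2) * cmod (pre_schwarzian f z)))"

definition is_root :: "real \<Rightarrow> real \<Rightarrow> bool" where
  "is_root c r \<longleftrightarrow> 0 < r \<and> r < 1 \<and>
     2 * (1 + r\<^sup>2) * (1 - sqrt (1 - c * r)) - c * (r + 3 * r ^ 3) = 0"

end

theory Submission
  imports Defs
begin

text \<open>
  For \<open>g\<close> in \<open>convex_q c\<close> one has \<open>z P\<^sub>g(z) = q c (\<omega> z) - 1\<close> with a Schwarz function \<open>\<omega>\<close>, and
  \<open>q c w - 1 = c w / (1 + q c w)\<close>, so the Schwarz lemma gives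
  \<open>(1 - r\<^sup>2) |P\<^sub>g(z)| \<le> (1 - r\<^sup>2) c / (1 + sqrt (1 - c r))\<close> for \<open>|z| = r\<close>. The right-hand side is
  largest at the root \<open>\<alpha>\<close>: once the square root is isolated and squared, the inequality between the
  values at \<open>r\<close> and \<open>\<alpha>\<close> is polynomial with a double zero at \<open>r = \<alpha>\<close>. Equality occurs at \<open>z = -\<alpha>\<close> for the function with
  \<open>\<omega> z = z\<close>.
\<close>

section \<open>The root equation: polynomial form, location and uniqueness of the root\<close>

text \<open>With \<open>s = sqrt (1 - c * r)\<close> one has \<open>c * r = 1 - s\<^sup>2\<close>,
  and the equation factors as
  \<open>(1 - s) * ((1 - r\<^sup>2) - s * (1 + 3 * r\<^sup>2)) = 0\<close>. As \<open>s < 1\<close>,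
  only the second factor can vanish. Both sides of
  \<open>s * (1 + 3 * r\<^sup>2) = 1 - r\<^sup>2\<close> are nonnegative, so squaring loses
  nothing.\<close>

lemma is_root_iff:
  assumes "0 < c" "c \<le> 1"
  shows "is_root c r \<longleftrightarrow> 0 < r \<and> r < 1 \<and> c * (1 + 3 * r\<^sup>2)\<^sup>2 = 8 * r * (1 + r\<^sup>2)"
proof (cases "0 < r \<and> r < 1")
  case True
  define s where "s = sqrt (1 - c * r)"
  have cr: "0 < c * r" "c * r < 1"
    using assms True by (auto intro: le_less_trans[OF mult_right_mono[of c 1 r]])
  then have s: "0 < s" "s < 1" "s\<^sup>2 = 1 - c * r" by (auto simp: s_def)
  have pos: "0 < 1 + 3 * r\<^sup>2" by (simp add: add_pos_nonneg)
  have "2 * (1 + r\<^sup>2) * (1 - s) - c * (r + 3 * r ^ 3)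
      = 2 * (1 + r\<^sup>2) * (1 - s) - (1 - s\<^sup>2) * (1 + 3 * r\<^sup>2)"
    unfolding s(3) by algebra
  also have "\<dots> = (1 - s) * ((1 - r\<^sup>2) - s * (1 + 3 * r\<^sup>2))"
    by algebra
  finally have "is_root c r \<longleftrightarrow> s * (1 + 3 * r\<^sup>2) = 1 - r\<^sup>2"
    using s True by (auto simp: is_root_def s_def[symmetric])
  also have "\<dots> \<longleftrightarrow> (s * (1 + 3 * r\<^sup>2))\<^sup>2 = (1 - r\<^sup>2)\<^sup>2"
    using s pos True by (subst power_eq_iff_eq_base) (auto simp: power_le_one)
  also have "\<dots> \<longleftrightarrow> r * (c * (1 + 3 * r\<^sup>2)\<^sup>2) = r * (8 * r * (1 + r\<^sup>2))"
    unfolding power_mult_distrib s(3) by algebra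
  finally show ?thesis using True by simp
qed (auto simp: is_root_def)

text \<open>This smallness drives both the uniqueness of the root and the numerical estimates in
  \<open>is_root_bound\<close>.\<close>

lemma is_root_le:
  assumes "0 < c" "c \<le> 1" "is_root c r"
  shows "r \<le> 1 / 7"
proof -
  have r: "0 < r" "r < 1" and eq: "c * (1 + 3 * r\<^sup>2)\<^sup>2 = 8 * r * (1 + r\<^sup>2)"
    using assms is_root_iff by auto
  have "8 * r * (1 + r\<^sup>2) \<le> (1 + 3 * r\<^sup>2)\<^sup>2"
    unfolding eq[symmetric] using assms by (simp add: mult_left_le_one_le)
  \<comment> \<open>For \<open>c = 1\<close> the polynomial equation also has the zero
    \<open>r = 1\<close>, which explains the factor \<open>1 - r\<close>. Dropping the nonnegative
    terms \<open>9 * r ^ 3 + r\<^sup>2\<close> of the cubic leaves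
    \<open>7 * r \<le> 1\<close>.\<close>
  then have "(1 - r) * (9 * r ^ 3 + r\<^sup>2 + 7 * r - 1) \<le> 0"
    by (simp add: power2_eq_square power3_eq_cube algebra_simps)
  then have "9 * r ^ 3 + r\<^sup>2 + 7 * r - 1 \<le> 0"
    using r by (simp add: mult_le_0_iff)
  moreover have "0 \<le> 9 * r ^ 3 + r\<^sup>2" using r by simp
  ultimately show ?thesis by simp
qed

lemma ex1_is_root:
  assumes "0 < c" "c \<le> 1"
  shows "\<exists>!r. is_root c r"
proof (rule ex_ex1I)
  let ?p = "\<lambda>r::real. 8 * r * (1 + r\<^sup>2) - c * (1 + 3 * r\<^sup>2)\<^sup>2"
  \<comment> \<open>The sign changes: \<open>?p 0 = - c\<close> and
    \<open>?p (1 / 7) = (2800 - 2704 * c) / 2401\<close>.\<close>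
  have "\<exists>r\<ge>0. r \<le> 1 / 7 \<and> ?p r = 0"
    by (rule IVT') (use assms in \<open>auto simp: power2_eq_square intro!: continuous_intros\<close>)
  then obtain r where r: "0 \<le> r" "r \<le> 1 / 7" "?p r = 0" by blast
  moreover have "r \<noteq> 0" using r(3) assms by auto
  ultimately show "\<exists>r. is_root c r"
    using assms is_root_iff by (intro exI[of _ r]) auto
next
  have False if "is_root c r" "is_root c t" "r < t" for r t
  proof -
    have bd: "0 < r" "t \<le> 1 / 7" using that assms is_root_le by (auto simp: is_root_def)
    have e: "c * (1 + 3 * r\<^sup>2)\<^sup>2 = 8 * r * (1 + r\<^sup>2)" "c * (1 + 3 * t\<^sup>2)\<^sup>2 = 8 * t * (1 + t\<^sup>2)"
      using that assms is_root_iff by auto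
    \<comment> \<open>The difference of the two root equations is divisible by \<open>t - r\<close>.
      In the quotient, \<open>3 * (t + r) < 1\<close> keeps the part with \<open>c\<close> too small
      to balance the part that starts with 8.\<close>
    have "(t - r) * (8 * (1 + t\<^sup>2 + t * r + r\<^sup>2) - c * (3 * (t + r) * (2 + 3 * t\<^sup>2 + 3 * r\<^sup>2))) = 0"
      using e by algebra
    then have *: "8 * (1 + t\<^sup>2 + t * r + r\<^sup>2) = c * (3 * (t + r) * (2 + 3 * t\<^sup>2 + 3 * r\<^sup>2))"
      using that by simp
    have "c * (3 * (t + r) * (2 + 3 * t\<^sup>2 + 3 * r\<^sup>2)) \<le> 3 * (t + r) * (2 + 3 * t\<^sup>2 + 3 * r\<^sup>2)"
      using assms bd that by (intro mult_left_le_one_le) auto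
    also have "\<dots> \<le> 1 * (2 + 3 * t\<^sup>2 + 3 * r\<^sup>2)"
      using bd that by (intro mult_right_mono) auto
    finally have "8 * (1 + t\<^sup>2 + t * r + r\<^sup>2) \<le> 2 + 3 * t\<^sup>2 + 3 * r\<^sup>2" using * by simp
    moreover have "0 < t * r" using bd that by auto
    ultimately show False using zero_le_power2[of t] zero_le_power2[of r] by argo
  qed
  then show "r = t" if "is_root c r" "is_root c t" for r t
    using that by (metis linorder_neq_iff)
qed

section \<open>Maximum of the radial majorant\<close>

lemma is_root_bound:
  assumes c: "0 < c" "c \<le> 1" and a: "is_root c a" and r: "0 \<le> r" "r < 1"
  shows "(1 - r\<^sup>2) * (c / (1 + sqrt (1 - c * r))) \<le> (1 - a\<^sup>2) * (1 - sqrt (1 - c * a)) / a"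
proof -
  have a': "0 < a" "a \<le> 1 / 7" and eq: "c * (1 + 3 * a\<^sup>2)\<^sup>2 = 8 * a * (1 + a\<^sup>2)"
    using assms is_root_iff is_root_le by auto
  have a2: "a\<^sup>2 \<le> 1 / 49" using a' power_mono[of a "1/7" 2] by (simp add: power2_eq_square)
  define u v where "u = 1 + 3 * a\<^sup>2" and "v = 1 - a\<^sup>2"
  have uv: "1 \<le> u" "0 < v" using a2 by (auto simp: u_def v_def)
  \<comment> \<open>\<open>K\<close> is the value of
    \<open>(1 + sqrt (1 - c * r)) / (1 - r\<^sup>2)\<close> at \<open>r = a\<close>, because
    \<open>sqrt (1 - c * a) = v / u\<close> and \<open>u + v = 2 * (1 + a\<^sup>2)\<close>. The
    claim thus becomes \<open>K * (1 - r\<^sup>2) - 1 \<le> sqrt (1 - c * r)\<close>, with equality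
    at \<open>a\<close>.\<close>
  define K where "K = 2 * (1 + a\<^sup>2) / (u * v)"
  have K: "K * (u * v) = 2 * (1 + a\<^sup>2)" using uv by (simp add: K_def)
  have K_le: "K \<le> 2"
  proof -
    have "a\<^sup>2 * (3 * a\<^sup>2) \<le> a\<^sup>2 * 1" using a2 by (intro mult_left_mono) auto
    then have "2 * (1 + a\<^sup>2) \<le> 2 * (u * v)" by (simp add: u_def v_def algebra_simps)
    then show ?thesis using uv by (simp add: K_def divide_simps)
  qed
  have K_ge: "9 / 5 \<le> K"
  proof -
    have "0 \<le> a ^ 4" by simp
    moreover have "5 * (2 * (1 + a\<^sup>2) - 9 / 5 * (u * v)) = 1 - 8 * a\<^sup>2 + 27 * a ^ 4"
      unfolding u_def v_def by (simp add: algebra_simps)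
    ultimately have "9 / 5 * (u * v) \<le> 2 * (1 + a\<^sup>2)" using a2 by argo
    then show ?thesis using uv by (simp add: K_def divide_simps)
  qed
  have cu: "c * u = 4 * a * (K * v)"
  proof -
    have "u * (c * u) = u * (4 * a * (K * v))" using eq K unfolding u_def by algebra
    then show ?thesis using uv by simp
  qed
  have sa: "sqrt (1 - c * a) = v / u"
  proof (rule real_sqrt_unique)
    have "v\<^sup>2 = (1 - c * a) * u\<^sup>2" using eq unfolding u_def v_def by algebra
    then show "(v / u)\<^sup>2 = 1 - c * a" using uv by (simp add: power_divide)
  qed (use uv in auto)
  have "K * (v * (u - v)) = c * (u * a)" using cu unfolding u_def v_def by algebra
  then have rhs: "(1 - a\<^sup>2) * (1 - sqrt (1 - c * a)) / a = c / K"
    unfolding sa v_def[symmetric] using uv a' K_ge by (simp add: field_simps)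
  have cr: "c * r < 1"
    using c r by (auto intro: le_less_trans[OF mult_right_mono[of c 1 r]])
  have "K * (1 - r\<^sup>2) - 1 \<le> sqrt (1 - c * r)"
  proof (cases "K * (1 - r\<^sup>2) \<le> 1")
    case True
    moreover have "0 \<le> sqrt (1 - c * r)" using cr by simp
    ultimately show ?thesis by linarith
  next
    case False
    \<comment> \<open>Found by matching the coefficients of \<open>r\<^sup>2\<close> in the identity
      \<open>id\<close> below. The facts \<open>ce\<close> and \<open>e1\<close> match the linear
      and the constant coefficients.\<close>
    define e where "e = 2 * K * (K - 1 - a\<^sup>2 * K)"
    have Kv: "u * (K * v) = 2 + 2 * a\<^sup>2" using K by algebra
    have "u * c = u * (2 * a * e)"
      using cu Kv unfolding e_def u_def v_def by algebra
    then have ce: "c = 2 * a * e" using uv by simp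
    have "u * (e * a\<^sup>2 - a ^ 4 * K\<^sup>2) = u * (2 * K - K\<^sup>2)"
      using Kv unfolding e_def u_def v_def by algebra
    then have e1: "e * a\<^sup>2 - a ^ 4 * K\<^sup>2 = 2 * K - K\<^sup>2" using uv by simp
    have id: "1 - c * r - (K * (1 - r\<^sup>2) - 1)\<^sup>2 = (r - a)\<^sup>2 * (e - K\<^sup>2 * (r + a)\<^sup>2)"
      using e1 unfolding ce e_def by algebra
    \<comment> \<open>It remains to see that the cofactor of the double zero is nonnegative. The
      case assumption and \<open>K \<le> 2\<close> confine \<open>r\<close>, giving
      \<open>K * (r + a)\<^sup>2 \<le> 16 / 11\<close>, while \<open>9 / 5 \<le> K\<close> makes
      \<open>2 * (K - 1 - a\<^sup>2 * K)\<close> exceed \<open>3 / 2\<close>.\<close>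
    have "K * (1 - r\<^sup>2) \<le> 2 * (1 - r\<^sup>2)"
      using K_le r by (intro mult_right_mono) (auto simp: power_le_one)
    then have r2: "r\<^sup>2 \<le> 1 / 2" using False by simp
    have r57: "r \<le> 5 / 7"
      by (rule power2_le_imp_le) (use r2 in \<open>auto simp: power2_eq_square\<close>)
    have "r * a \<le> 5 / 7 * (1 / 7)" using r57 r a' by (intro mult_mono) auto
    then have "(r + a)\<^sup>2 \<le> 8 / 11" using r2 a2 by (simp add: power2_sum)
    then have "K * (r + a)\<^sup>2 \<le> 2 * (8 / 11)" using K_le by (intro mult_mono) auto
    moreover have "a\<^sup>2 * K \<le> 1 / 49 * K" using a2 K_ge by (intro mult_right_mono) auto
    ultimately have "K * (r + a)\<^sup>2 \<le> 2 * (K - 1 - a\<^sup>2 * K)" using K_ge by argo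
    then have "K * (K * (r + a)\<^sup>2) \<le> K * (2 * (K - 1 - a\<^sup>2 * K))"
      using K_ge by (intro mult_left_mono) auto
    then have "0 \<le> e - K\<^sup>2 * (r + a)\<^sup>2" unfolding e_def by (simp add: power2_eq_square algebra_simps)
    then have "0 \<le> (r - a)\<^sup>2 * (e - K\<^sup>2 * (r + a)\<^sup>2)" by simp
    then have "(K * (1 - r\<^sup>2) - 1)\<^sup>2 \<le> 1 - c * r" unfolding id[symmetric] by simp
    then show ?thesis by (rule real_le_rsqrt)
  qed
  then have "1 - r\<^sup>2 \<le> (1 + sqrt (1 - c * r)) / K"
    using K_ge by (simp add: pos_le_divide_eq mult.commute)
  moreover have pos: "0 < 1 + sqrt (1 - c * r)" using cr by (simp add: add_pos_nonneg)
  ultimately have "(1 - r\<^sup>2) * (c / (1 + sqrt (1 - c * r)))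
      \<le> (1 + sqrt (1 - c * r)) / K * (c / (1 + sqrt (1 - c * r)))"
    using c by (intro mult_right_mono) auto
  also have "\<dots> = c / K" using pos by simp
  finally show ?thesis unfolding rhs .
qed

section \<open>Analytic preliminaries: locality of the norm and estimates for
  \<open>q c\<close>\<close>

lemma pre_schwarzian_norm_cong:
  assumes "\<And>z. z \<in> ball 0 1 \<Longrightarrow> f z = g z"
  shows "pre_schwarzian_norm f = pre_schwarzian_norm g"
proof -
  have d: "deriv f z = deriv g z" if "z \<in> ball 0 1" for z
    using assms that by (intro deriv_cong_ev) (auto intro!: eventually_nhds_in_open[THEN eventually_mono, of "ball 0 1"])
  moreover have "deriv (deriv f) z = deriv (deriv g) z" if "z \<in> ball 0 1" for z
    using d that by (intro deriv_cong_ev) (auto intro!: eventually_nhds_in_open[THEN eventually_mono, of "ball 0 1"])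
  ultimately show ?thesis
    unfolding pre_schwarzian_norm_def pre_schwarzian_def by (intro SUP_cong) auto
qed

text \<open>Keeps the radicand off the branch cut of \<open>csqrt\<close>.\<close>

lemma Re_radicand_pos:
  assumes "0 < c" "c \<le> 1" "cmod w < 1"
  shows "0 < Re (1 + complex_of_real c * w)"
proof -
  have "\<bar>c * Re w\<bar> \<le> 1 * cmod w"
    unfolding abs_mult using assms abs_Re_le_cmod[of w] by (intro mult_mono) auto
  then show ?thesis using assms by simp
qed

lemma q_holomorphic:
  assumes "0 < c" "c \<le> 1"
  shows "q c holomorphic_on ball 0 1"
  unfolding q_def
  by (intro holomorphic_intros)
     (use Re_radicand_pos[OF assms] in \<open>force simp: complex_nonpos_Reals_iff\<close>)

lemma q_sq: "(q c w)\<^sup>2 = 1 + complex_of_real c * w"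
  by (simp add: q_def)

text \<open>The real part of \<open>csqrt u\<close> is \<open>sqrt ((cmod u + Re u) / 2)\<close>,
  hence at least \<open>sqrt (Re u)\<close> when \<open>Re u\<close> is nonnegative; here
  \<open>Re u\<close> is at least \<open>1 - c * r\<close>.\<close>

lemma cmod_1_plus_q_ge:
  assumes "0 < c" "c \<le> 1" "cmod w \<le> r" "r < 1"
  shows "1 + sqrt (1 - c * r) \<le> cmod (1 + q c w)"
proof -
  let ?u = "1 + complex_of_real c * w"
  have "c * - Re w \<le> c * r"
    using assms abs_Re_le_cmod[of w] by (intro mult_left_mono) auto
  then have "1 - c * r \<le> Re ?u" by simp
  also have "\<dots> \<le> (cmod ?u + Re ?u) / 2"
    using complex_Re_le_cmod[of ?u] by simp
  finally have "sqrt (1 - c * r) \<le> Re (q c w)"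
    unfolding q_def csqrt.simps by (rule real_sqrt_le_mono)
  then show ?thesis using complex_Re_le_cmod[of "1 + q c w"] by simp
qed

lemma one_plus_q_neq_0:
  assumes "0 < c" "c \<le> 1" "cmod w < 1"
  shows "1 + q c w \<noteq> 0"
proof
  assume "1 + q c w = 0"
  then have "1 + sqrt (1 - c * cmod w) \<le> 0" using cmod_1_plus_q_ge[of c w "cmod w"] assms by auto
  moreover have "c * cmod w \<le> 1 * 1" using assms by (intro mult_mono) auto
  then have "0 \<le> sqrt (1 - c * cmod w)" by simp
  ultimately show False by linarith
qed

lemma q_minus_1:
  assumes "0 < c" "c \<le> 1" "cmod w < 1"
  shows "q c w - 1 = c * w / (1 + q c w)"
proof -
  have "1 + q c w \<noteq> 0" by (rule one_plus_q_neq_0[OF assms])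
  moreover have "(q c w - 1) * (1 + q c w) = c * w" using q_sq[of c w] by algebra
  ultimately show ?thesis by (simp add: field_simps)
qed

text \<open>Numerator and denominator of \<open>q_minus_1\<close> are estimated separately, yet
  nothing is lost at \<open>w = - r\<close>, where both estimates are equalities. This is the source
  of sharpness.\<close>

lemma q_minus_1_le:
  assumes "0 < c" "c \<le> 1" "cmod w \<le> r" "r < 1"
  shows "cmod (q c w - 1) \<le> c * r / (1 + sqrt (1 - c * r))"
proof -
  have "0 \<le> r" using assms(3) norm_ge_zero[of w] by linarith
  then have "c * r \<le> 1 * 1" using assms by (intro mult_mono) auto
  then have "0 < 1 + sqrt (1 - c * r)" by (simp add: add_pos_nonneg)
  then show ?thesis
    using assms \<open>0 \<le> r\<close> cmod_1_plus_q_ge[OF assms] q_minus_1[of c w]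
    by (auto simp: norm_divide norm_mult intro!: frac_le mult_left_mono)
qed

section \<open>Upper bound for the norm on \<open>convex_q c\<close>\<close>

lemma convex_q_pre_schwarzian_norm_le:
  assumes c: "0 < c" "c \<le> 1" and a: "is_root c a" and g: "g \<in> convex_q c"
  shows "pre_schwarzian_norm g \<le> ereal ((1 - a\<^sup>2) * (1 - sqrt (1 - c * a)) / a)"
proof -
  let ?P = "pre_schwarzian g" and ?M = "(1 - a\<^sup>2) * (1 - sqrt (1 - c * a)) / a"
  let ?F = "\<lambda>z. (1 - (cmod z)\<^sup>2) * cmod (?P z)"
  obtain \<omega> where \<omega>: "\<omega> holomorphic_on ball 0 1" "\<omega> ` ball 0 1 \<subseteq> ball 0 1" "\<omega> 0 = 0"
      and sub: "\<And>z. cmod z < 1 \<Longrightarrow> 1 + z * deriv (deriv g) z / deriv g z = q c (\<omega> z)"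
    using g unfolding convex_q_def subordinate_def by auto
  have hol: "g holomorphic_on ball 0 1" and nz: "\<And>z. z \<in> ball 0 1 \<Longrightarrow> deriv g z \<noteq> 0"
    using g by (auto simp: convex_q_def class_A_def)
  have punctured: "?F z \<le> ?M" if z: "cmod z < 1" "z \<noteq> 0" for z
  proof -
    have "cmod (\<omega> z) \<le> cmod z"
      using \<omega> z by (intro Schwarz_Lemma) (auto simp: image_subset_iff)
    then have "cmod (q c (\<omega> z) - 1) \<le> c * cmod z / (1 + sqrt (1 - c * cmod z))"
      using c z by (intro q_minus_1_le) auto
    moreover have "q c (\<omega> z) - 1 = z * ?P z"
      using sub[of z] z by (simp add: pre_schwarzian_def algebra_simps)
    ultimately have "cmod z * cmod (?P z) \<le> cmod z * (c / (1 + sqrt (1 - c * cmod z)))"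
      by (simp add: norm_mult mult_ac)
    then have "cmod (?P z) \<le> c / (1 + sqrt (1 - c * cmod z))"
      by (rule mult_left_le_imp_le) (use z in simp)
    then have "?F z \<le> (1 - (cmod z)\<^sup>2) * (c / (1 + sqrt (1 - c * cmod z)))"
      using z by (intro mult_left_mono) (auto simp: power_le_one)
    also have "\<dots> \<le> ?M" using is_root_bound[OF c a] z by simp
    finally show ?thesis .
  qed
  \<comment> \<open>At \<open>z = 0\<close> the subordination identity says nothing about
    \<open>?P 0\<close>, which enters multiplied by \<open>z\<close>. The bound passes to the origin
    by continuity.\<close>
  have "?P holomorphic_on ball 0 1"
    unfolding pre_schwarzian_def using hol nz by (intro holomorphic_intros) auto
  then have "isCont ?P 0"
    by (intro continuous_on_interior[OF holomorphic_on_imp_continuous_on]) auto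
  then have lim: "(?F \<longlongrightarrow> ?F 0) (at 0)"
    unfolding isCont_def by (intro tendsto_intros)
  have "\<forall>\<^sub>F z in at 0. ?F z \<le> ?M"
    unfolding eventually_at by (intro exI[of _ 1]) (use punctured in auto)
  then have "?F 0 \<le> ?M"
    by (rule tendsto_upperbound[OF lim]) simp
  with punctured have "\<And>z. cmod z < 1 \<Longrightarrow> ?F z \<le> ?M"
    by (case_tac "z = 0") auto
  then show ?thesis
    unfolding pre_schwarzian_norm_def by (intro SUP_least) auto
qed

section \<open>The Alexander transform and the extremal pair\<close>

lemma alexander_eq_primitive:
  assumes g: "\<And>z. z \<in> ball 0 1 \<Longrightarrow> (g has_field_derivative g' z) (at z)"
    and f: "\<And>z. z \<in> ball 0 1 - {0} \<Longrightarrow> f z / z = g' z"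
    and z: "z \<in> ball 0 1"
  shows "alexander f z = g z - g 0"
proof (cases "z = 0")
  case False
  have "(g' has_contour_integral (g (pathfinish (linepath 0 z)) - g (pathstart (linepath 0 z)))) (linepath 0 z)"
  proof (rule contour_integral_primitive)
    show "path_image (linepath 0 z) \<subseteq> ball 0 1"
      using z by (simp add: closed_segment_subset)
  qed (auto intro: has_field_derivative_at_within[OF g] simp del: linepath_0)
  then have "((\<lambda>t. g' (linepath 0 z t) * (z - 0)) has_integral (g z - g 0)) {0..1}"
    by (simp add: has_contour_integral_linepath)
  \<comment> \<open>At parameter 0 the quotient is a division by zero with default value 0, which
    may differ from \<open>g' 0\<close>. One point does not change the integral.\<close>
  then have "((\<lambda>t. f (linepath 0 z t) / linepath 0 z t * (z - 0)) has_integral (g z - g 0)) {0..1}"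
  proof (rule has_integral_spike_finite[rotated 2, of _ _ _ "{0}"])
    fix t :: real assume t: "t \<in> {0..1} - {0}"
    then have "linepath 0 z t \<in> ball 0 1"
      using z by (auto simp: linepath_def intro!: le_less_trans[OF mult_left_le_one_le[of "cmod z" t]])
    moreover have "linepath 0 z t \<noteq> 0" using t False by (simp add: linepath_def)
    ultimately show "f (linepath 0 z t) / linepath 0 z t * (z - 0) = g' (linepath 0 z t) * (z - 0)"
      using f by simp
  qed auto
  then show ?thesis
    unfolding alexander_def by (intro contour_integral_unique) (simp add: has_contour_integral_linepath)
qed (simp add: alexander_def)

text \<open>On the punctured disc this is \<open>(q c z - 1) / z\<close>, in a form that is regular
  at the origin.\<close>

definition extremal_log_deriv :: "real \<Rightarrow> complex \<Rightarrow> complex" where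
  "extremal_log_deriv c z = c / (1 + q c z)"

lemma extremal_log_deriv_mult:
  assumes "0 < c" "c \<le> 1" "cmod z < 1"
  shows "1 + z * extremal_log_deriv c z = q c z"
  using q_minus_1[OF assms] by (simp add: extremal_log_deriv_def algebra_simps)

lemma cmod_extremal_log_deriv:
  assumes c: "0 < c" "c \<le> 1" and a: "0 < a" "a < 1"
  shows "cmod (extremal_log_deriv c (- of_real a)) = (1 - sqrt (1 - c * a)) / a"
proof -
  have "c * a \<le> 1 * 1" using assms by (intro mult_mono) auto
  then have "q c (- of_real a) = of_real (sqrt (1 - c * a))"
    by (simp add: q_def)
  moreover have "1 + (- of_real a) * extremal_log_deriv c (- of_real a) = q c (- of_real a)"
    using assms by (intro extremal_log_deriv_mult) auto
  ultimately have "of_real a * extremal_log_deriv c (- of_real a) = of_real (1 - sqrt (1 - c * a))"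
    by (simp add: algebra_simps)
  then have "extremal_log_deriv c (- of_real a) = of_real ((1 - sqrt (1 - c * a)) / a)"
    using a by (simp add: field_simps)
  moreover have "0 \<le> (1 - sqrt (1 - c * a)) / a" using assms by simp
  ultimately show ?thesis by (simp only: norm_of_real abs_of_nonneg)
qed

text \<open>Taking the identity as Schwarz function prescribes the logarithmic derivative of
  \<open>deriv g\<close>. Hence \<open>deriv g = exp H\<close> for a primitive \<open>H\<close> of
  \<open>extremal_log_deriv c\<close>, and \<open>f z = z * deriv g z\<close> inverts the Alexander
  transform.\<close>

lemma extremal_pair:
  assumes c: "0 < c" "c \<le> 1"
  obtains f g where "f \<in> starlike_q c" "g \<in> convex_q c"
    "\<And>z. z \<in> ball 0 1 \<Longrightarrow> g z = alexander f z"
    "\<And>z. z \<in> ball 0 1 \<Longrightarrow> pre_schwarzian g z = extremal_log_deriv c z"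
proof -
  let ?k = "extremal_log_deriv c"
  have qhol: "q c holomorphic_on ball 0 1" by (rule q_holomorphic[OF c])
  then have "?k holomorphic_on ball 0 1"
    unfolding extremal_log_deriv_def using one_plus_q_neq_0[OF c] by (intro holomorphic_intros) auto
  then obtain H0 where H0: "\<And>z. z \<in> ball 0 1 \<Longrightarrow> (H0 has_field_derivative ?k z) (at z)"
    using holomorphic_convex_primitive'[of "ball 0 1" ?k] by (auto simp: at_within_open[of _ "ball 0 1"])
  \<comment> \<open>The constant is chosen so that \<open>exp (H 0) = 1\<close>, which normalises
    both derivatives at 0.\<close>
  define H where "H z = H0 z - H0 0" for z
  have H: "(H has_field_derivative ?k z) (at z)" if "z \<in> ball 0 1" for z
    unfolding H_def using H0[OF that] by (auto intro!: derivative_eq_intros)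
  have E: "((\<lambda>z. exp (H z)) has_field_derivative exp (H z) * ?k z) (at z)" if "z \<in> ball 0 1" for z
    using H[OF that] by (auto intro!: derivative_eq_intros)
  then have "(\<lambda>z. exp (H z)) holomorphic_on ball 0 1"
    unfolding holomorphic_on_open[OF open_ball] by blast
  then obtain G0 where G0: "\<And>z. z \<in> ball 0 1 \<Longrightarrow> (G0 has_field_derivative exp (H z)) (at z)"
    using holomorphic_convex_primitive'[of "ball 0 1" "\<lambda>z. exp (H z)"]
    by (auto simp: at_within_open[of _ "ball 0 1"])
  define g where "g z = G0 z - G0 0" for z
  define f where "f z = z * exp (H z)" for z
  have g: "(g has_field_derivative exp (H z)) (at z)" if "z \<in> ball 0 1" for z
    unfolding g_def using G0[OF that] by (auto intro!: derivative_eq_intros)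
  have f: "(f has_field_derivative exp (H z) * q c z) (at z)" if "z \<in> ball 0 1" for z
  proof -
    have "(f has_field_derivative exp (H z) * (1 + z * ?k z)) (at z)"
      unfolding f_def using DERIV_mult[OF DERIV_ident E[OF that]] by (simp add: algebra_simps)
    then show ?thesis using extremal_log_deriv_mult[OF c] that by simp
  qed
  have dg: "deriv g z = exp (H z)" if "z \<in> ball 0 1" for z
    using g[OF that] by (rule DERIV_imp_deriv)
  have "deriv (deriv g) z = deriv (\<lambda>z. exp (H z)) z" if "z \<in> ball 0 1" for z
    using that dg by (intro deriv_cong_ev) (auto intro!: eventually_nhds_in_open[THEN eventually_mono, of "ball 0 1"])
  then have ddg: "deriv (deriv g) z = exp (H z) * ?k z" if "z \<in> ball 0 1" for z
    using that DERIV_imp_deriv[OF E[OF that]] by simp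
  have df: "deriv f z = exp (H z) * q c z" if "z \<in> ball 0 1" for z
    using f[OF that] by (rule DERIV_imp_deriv)
  \<comment> \<open>Serves both memberships: the starlike and the convex quotient coincide with
    \<open>q c\<close> on the disc. At the origin the convention value 1 agrees with
    \<open>q c 0\<close>.\<close>
  have sub: "subordinate F (q c)" if F: "\<And>z. z \<in> ball 0 1 \<Longrightarrow> F z = q c z" for F
  proof -
    have "F holomorphic_on ball 0 1" using qhol F holomorphic_cong[OF refl] by blast
    with qhol F show ?thesis
      unfolding subordinate_def by (auto intro!: exI[of _ "\<lambda>z. z"] holomorphic_intros)
  qed
  have "f holomorphic_on ball 0 1" "g holomorphic_on ball 0 1"
    unfolding holomorphic_on_open[OF open_ball] using f g by blast+
  then have A: "f \<in> class_A" "g \<in> class_A"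
    using df[of 0] dg[of 0] by (auto simp: class_A_def f_def g_def H_def q_def)
  show ?thesis
  proof
    show "f \<in> starlike_q c"
      unfolding starlike_q_def using A
      by (auto intro!: sub simp: df) (auto simp: f_def q_def)
    show "g \<in> convex_q c"
      unfolding convex_q_def using A
      by (auto intro!: sub simp: dg ddg extremal_log_deriv_mult[OF c])
    show "g z = alexander f z" if "z \<in> ball 0 1" for z
      using alexander_eq_primitive[of g "\<lambda>z. exp (H z)" f z] g that by (auto simp: f_def g_def)
    show "pre_schwarzian g z = ?k z" if "z \<in> ball 0 1" for z
      using that by (simp add: pre_schwarzian_def dg ddg)
  qed
qed

section \<open>Root, bound and sharpness combined\<close>

theorem theorem2p4:
  fixes c :: real
  assumes "0 < c" and "c \<le> 1"
  shows "(\<exists>!\<alpha>. is_root c \<alpha>) \<and>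
    (\<forall>\<alpha>. is_root c \<alpha> \<longrightarrow>
      (\<forall>f g. f \<in> starlike_q c \<and> g \<in> convex_q c \<and> (\<forall>z\<in>ball 0 1. g z = alexander f z) \<longrightarrow>
         pre_schwarzian_norm g = pre_schwarzian_norm (alexander f) \<and>
         pre_schwarzian_norm g \<le> ereal ((1 - \<alpha>\<^sup>2) * (1 - sqrt (1 - c * \<alpha>)) / \<alpha>)) \<and>
      (\<exists>f g. f \<in> starlike_q c \<and> g \<in> convex_q c \<and> (\<forall>z\<in>ball 0 1. g z = alexander f z) \<and>
         pre_schwarzian_norm g = ereal ((1 - \<alpha>\<^sup>2) * (1 - sqrt (1 - c * \<alpha>)) / \<alpha>)))"
proof -
  have bound: "pre_schwarzian_norm g = pre_schwarzian_norm (alexander f) \<and>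
      pre_schwarzian_norm g \<le> ereal ((1 - \<alpha>\<^sup>2) * (1 - sqrt (1 - c * \<alpha>)) / \<alpha>)"
    if "is_root c \<alpha>" "g \<in> convex_q c" "\<forall>z\<in>ball 0 1. g z = alexander f z" for \<alpha> f g
    using that pre_schwarzian_norm_cong[of g "alexander f"]
      convex_q_pre_schwarzian_norm_le[OF assms, of \<alpha> g] by metis
  have sharp: "\<exists>f g. f \<in> starlike_q c \<and> g \<in> convex_q c \<and> (\<forall>z\<in>ball 0 1. g z = alexander f z) \<and>
      pre_schwarzian_norm g = ereal ((1 - \<alpha>\<^sup>2) * (1 - sqrt (1 - c * \<alpha>)) / \<alpha>)"
    if \<alpha>: "is_root c \<alpha>" for \<alpha>
  proof -
    have \<alpha>01: "0 < \<alpha>" "\<alpha> < 1" using \<alpha> by (auto simp: is_root_def)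
    obtain f g where fg: "f \<in> starlike_q c" "g \<in> convex_q c"
        "\<And>z. z \<in> ball 0 1 \<Longrightarrow> g z = alexander f z"
      and P: "\<And>z. z \<in> ball 0 1 \<Longrightarrow> pre_schwarzian g z = extremal_log_deriv c z"
      using extremal_pair[OF assms] by blast
    \<comment> \<open>The supremum is tested at \<open>- \<alpha>\<close>: on the negative axis the
      radial majorant is attained, and the radius \<open>\<alpha>\<close> maximises it.\<close>
    have "ereal ((1 - (cmod (- of_real \<alpha>))\<^sup>2) * cmod (pre_schwarzian g (- of_real \<alpha>)))
        \<le> pre_schwarzian_norm g"
      unfolding pre_schwarzian_norm_def using \<alpha>01 by (intro SUP_upper) auto
    then have "ereal ((1 - \<alpha>\<^sup>2) * (1 - sqrt (1 - c * \<alpha>)) / \<alpha>) \<le> pre_schwarzian_norm g"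
      using P[of "- of_real \<alpha>"] cmod_extremal_log_deriv[OF assms \<alpha>01] \<alpha>01 by simp
    moreover have "pre_schwarzian_norm g \<le> ereal ((1 - \<alpha>\<^sup>2) * (1 - sqrt (1 - c * \<alpha>)) / \<alpha>)"
      using convex_q_pre_schwarzian_norm_le[OF assms \<alpha> fg(2)] .
    ultimately show ?thesis using fg by (intro exI[of _ f] exI[of _ g]) auto
  qed
  show ?thesis
    using ex1_is_root[OF assms] bound sharp by meson
qed

end
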